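(* There is a countably compact regular Hausdorff topological space which is weakly Whyburn but not pseudoradial.
   Context: A space is countably compact if every countable open cover has a finite subcover. Given a space $X$, a set $B \subset X$ is an almost closed set converging to $x$ if $\overline{B} \setminus B = \{x\}$. A space $X$ is weakly Whyburn if for every non-closed set $A \subset X$ there is an almost closed set $B \subset A$ which converges to a point outside of $A$; equivalently, for every non-closed $A \subset X$ there is $B \subset A$ such that $\overline{B} \setminus A$ is a singleton. For an infinite cardinal $\kappa$, a transfinite sequence $\{x_\alpha : \alpha < \kappa\} \subset X$ converges to $x \in X$ if for every open neighbourhood $U$ of $x$ there is an ordinal $\beta < \kappa$ such that $\{x_\alpha : \beta < \alpha < \kappa\} \subset U$. A space $X$ is pseudoradial if for every non-closed set $A \subset X$ there are a point $x \in \overline{A} \setminus A$ and a transfinite sequence $\{x_\alpha : \alpha < \kappa\} \subset A$ ($\kappa$ an infinite cardinal) converging to $x$. *)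

theory Defs
  imports "HOL-Analysis.Analysis"
begin

definition countably_compact_space :: "'a topology \<Rightarrow> bool" where
  "countably_compact_space X \<longleftrightarrow>
     (\<forall>\<C>. countable \<C> \<and> (\<forall>U\<in>\<C>. openin X U) \<and> topspace X \<subseteq> \<Union>\<C> \<longrightarrow>
        (\<exists>\<D>. finite \<D> \<and> \<D> \<subseteq> \<C> \<and> topspace X \<subseteq> \<Union>\<D>))"

definition almost_closed_converging :: "'a topology \<Rightarrow> 'a set \<Rightarrow> 'a \<Rightarrow> bool" where
  "almost_closed_converging X B x \<longleftrightarrow> B \<subseteq> topspace X \<and> (X closure_of B) - B = {x}"

definition weakly_Whyburn :: "'a topology \<Rightarrow> bool" where
  "weakly_Whyburn X \<longleftrightarrow>
     (\<forall>A. A \<subseteq> topspace X \<and> \<not> closedin X A \<longrightarrow>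
        (\<exists>B x. B \<subseteq> A \<and> x \<notin> A \<and> almost_closed_converging X B x))"

text \<open>
  A transfinite sequence \<open>{x\<^sub>\<alpha> : \<alpha> < \<kappa>}\<close> is a function on the field of a cardinal
  order \<open>r\<close> (a well-order of the least order type of its cardinality, playing the
  role of \<open>\<kappa>\<close>); \<open>aboveS r \<beta>\<close> is the set of all \<open>\<alpha>\<close> with \<open>\<beta> < \<alpha> < \<kappa>\<close>.
\<close>

definition transfinite_converges :: "'a topology \<Rightarrow> 'i rel \<Rightarrow> ('i \<Rightarrow> 'a) \<Rightarrow> 'a \<Rightarrow> bool" where
  "transfinite_converges X r f x \<longleftrightarrow>
     f ` Field r \<subseteq> topspace X \<and> x \<in> topspace X \<and>
     (\<forall>U. openin X U \<and> x \<in> U \<longrightarrow> (\<exists>\<beta>\<in>Field r. f ` aboveS r \<beta> \<subseteq> U))"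

text \<open>
  A definition cannot quantify over the type of indices, so \<open>\<kappa>\<close> ranges here over the
  infinite cardinal orders on subsets of \<^typ>\<open>'a + nat\<close>. This loses nothing: by
  \<open>transfinite_converges_reindex\<close> below, a sequence in \<open>A\<close> indexed by an infinite
  cardinal on any type whatsoever can be replaced by one of this form with the same
  limit.
\<close>

definition pseudoradial :: "'a topology \<Rightarrow> bool" where
  "pseudoradial X \<longleftrightarrow>
     (\<forall>A. A \<subseteq> topspace X \<and> \<not> closedin X A \<longrightarrow>
        (\<exists>x \<in> (X closure_of A) - A. \<exists>(r :: ('a + nat) rel) f.
            Cinfinite r \<and> f ` Field r \<subseteq> A \<and> transfinite_converges X r f x))"

lemma transfinite_converges_reindex:
  fixes X :: "'a topology" and r :: "'i rel" and f :: "'i \<Rightarrow> 'a"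
  assumes r: "Cinfinite r" and fA: "f ` Field r \<subseteq> A" and conv: "transfinite_converges X r f x"
  shows "\<exists>(r' :: ('a + nat) rel) g.
           Cinfinite r' \<and> g ` Field r' \<subseteq> A \<and> transfinite_converges X r' g x"
proof -
  have inf: "infinite (Field r)" and card: "Card_order r"
    using r by (auto simp: cinfinite_def)
  interpret r: wo_rel r
    using card by (auto simp: wo_rel_def card_order_on_def)
  have no_max: "\<exists>b\<in>Field r. a \<noteq> b \<and> (a, b) \<in> r" if "a \<in> Field r" for a
    using infinite_Card_order_limit[OF card inf that] by auto
  have refl_r: "(a, a) \<in> r" if "a \<in> Field r" for a
    using r.REFL that by (auto simp: refl_on_def)
  have trans_r: "(a, c) \<in> r" if "(a, b) \<in> r" "(b, c) \<in> r" for a b c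
    using r.TRANS that unfolding trans_def by blast
  have antisym_r: "a = b" if "(a, b) \<in> r" "(b, a) \<in> r" for a b
    using r.ANTISYM that unfolding antisym_def by blast
  have total_r: "(a, b) \<in> r \<or> (b, a) \<in> r" if "a \<in> Field r" "b \<in> Field r" for a b
    using r.TOTALS that by auto
  have key: ?thesis
    if h: "h ` Field r' \<subseteq> Field r" and r': "Cinfinite r'"
      and tail: "\<And>\<gamma>. \<gamma> \<in> Field r \<Longrightarrow> \<exists>\<beta>\<in>Field r'. f ` h ` aboveS r' \<beta> \<subseteq> f ` aboveS r \<gamma>"
    for r' :: "('a + nat) rel" and h
  proof (intro exI conjI)
    show "BNF_Cardinal_Arithmetic.cinfinite r'" "Card_order r'" using r' by auto
    show "(f \<circ> h) ` Field r' \<subseteq> A" using h fA by auto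
    show "transfinite_converges X r' (f \<circ> h) x"
      unfolding transfinite_converges_def
    proof (intro conjI allI impI)
      show "(f \<circ> h) ` Field r' \<subseteq> topspace X" "x \<in> topspace X"
        using h conv by (auto simp: transfinite_converges_def)
      fix U assume "openin X U \<and> x \<in> U"
      then obtain \<gamma> where g: "\<gamma> \<in> Field r" "f ` aboveS r \<gamma> \<subseteq> U"
        using conv unfolding transfinite_converges_def by blast
      from tail[OF g(1)] obtain \<beta> where "\<beta> \<in> Field r'" "f ` h ` aboveS r' \<beta> \<subseteq> f ` aboveS r \<gamma>"
        by blast
      with g(2) show "\<exists>\<beta>\<in>Field r'. (f \<circ> h) ` aboveS r' \<beta> \<subseteq> U"
        unfolding image_comp[symmetric] by blast
    qed
  qed
  show ?thesis
  proof (cases "\<exists>a\<in>Field r. \<forall>\<gamma>\<in>Field r. \<exists>\<alpha>\<in>aboveS r \<gamma>. f \<alpha> = f a")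
    case True
    then obtain a where a: "a \<in> Field r"
      and cof: "\<And>\<gamma>. \<gamma> \<in> Field r \<Longrightarrow> \<exists>\<alpha>\<in>aboveS r \<gamma>. f \<alpha> = f a" by blast
    let ?r = "card_of (UNIV :: ('a + nat) set)"
    have F: "Field ?r = UNIV" by (rule Field_card_of)
    show ?thesis
    proof (rule key[of "\<lambda>_. a" ?r])
      show "(\<lambda>_. a) ` Field ?r \<subseteq> Field r" using a by auto
      show "Cinfinite ?r"
        using card_of_Card_order[of "UNIV :: ('a + nat) set"]
        by (simp add: cinfinite_def Field_card_of finite_Plus_UNIV_iff)
      fix \<gamma> assume "\<gamma> \<in> Field r"
      from cof[OF this] have "f a \<in> f ` aboveS r \<gamma>" by (metis imageI)
      then have "f ` (\<lambda>_. a) ` S \<subseteq> f ` aboveS r \<gamma>" for S :: "('a + nat) set" by auto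
      then show "\<exists>\<beta>\<in>Field ?r. f ` (\<lambda>_. a) ` aboveS ?r \<beta> \<subseteq> f ` aboveS r \<gamma>"
        unfolding F by blast
    qed
  next
    case False
    define bd where "bd a = (SOME \<gamma>. \<gamma> \<in> Field r \<and> (\<forall>\<alpha>\<in>aboveS r \<gamma>. f \<alpha> \<noteq> a))" for a
    have bd: "bd (f a) \<in> Field r" "\<forall>\<alpha>\<in>aboveS r (bd (f a)). f \<alpha> \<noteq> f a" if "a \<in> Field r" for a
    proof -
      have "\<exists>\<gamma>. \<gamma> \<in> Field r \<and> (\<forall>\<alpha>\<in>aboveS r \<gamma>. f \<alpha> \<noteq> f a)" using False that by blast
      from someI_ex[OF this] show "bd (f a) \<in> Field r" "\<forall>\<alpha>\<in>aboveS r (bd (f a)). f \<alpha> \<noteq> f a"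
        unfolding bd_def by blast+
    qed
    have above_bd: "(a, bd (f a)) \<in> r" if a: "a \<in> Field r" for a
    proof (rule ccontr)
      assume n: "(a, bd (f a)) \<notin> r"
      then have "(bd (f a), a) \<in> r" using total_r[OF a bd(1)[OF a]] by blast
      moreover have "a \<noteq> bd (f a)" using n refl_r[OF a] by metis
      ultimately have "a \<in> aboveS r (bd (f a))" by (auto simp: aboveS_def)
      then show False using bd(2)[OF a] by blast
    qed
    define P where "P s \<longleftrightarrow> Card_order s \<and> (\<exists>c. c ` Field s \<subseteq> Field r \<and>
        (\<forall>\<gamma>\<in>Field r. \<exists>\<beta>\<in>Field s. (\<gamma>, c \<beta>) \<in> r))" for s :: "('a + nat) rel"
    have P0: "P (card_of (Inl ` f ` Field r))"
      unfolding P_def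
    proof (intro conjI exI[of _ "\<lambda>z. bd (projl z)"] ballI)
      show "Card_order (card_of (Inl ` f ` Field r :: ('a + nat) set))" by (rule card_of_Card_order)
      show "(\<lambda>z. bd (projl z)) ` Field (card_of (Inl ` f ` Field r :: ('a + nat) set)) \<subseteq> Field r"
        unfolding Field_card_of using bd(1) by auto
      fix \<gamma> assume "\<gamma> \<in> Field r"
      then show "\<exists>\<beta>\<in>Field (card_of (Inl ` f ` Field r :: ('a + nat) set)). (\<gamma>, bd (projl \<beta>)) \<in> r"
        unfolding Field_card_of using above_bd by force
    qed
    obtain s where Ps: "P s" and least: "\<And>t. (t, s) \<in> ordLess \<Longrightarrow> \<not> P t"
      using wfE_min[OF wf_ordLess, of _ "Collect P"] P0 by (metis mem_Collect_eq)
    then obtain c where cards: "Card_order s" and c: "c ` Field s \<subseteq> Field r"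
      and cof: "\<And>\<gamma>. \<gamma> \<in> Field r \<Longrightarrow> \<exists>\<beta>\<in>Field s. (\<gamma>, c \<beta>) \<in> r"
      unfolding P_def by blast
    have infs: "infinite (Field s)"
    proof
      assume fin: "finite (Field s)"
      have "\<exists>m\<in>Field r. \<forall>\<beta>\<in>S. (c \<beta>, m) \<in> r" if "finite S" "S \<subseteq> Field s" for S
        using that
      proof (induction S rule: finite_induct)
        case empty
        have "Field r \<noteq> {}" using inf by (metis finite.emptyI)
        then show ?case by blast
      next
        case (insert b S)
        then obtain m where m: "m \<in> Field r" "\<forall>\<beta>\<in>S. (c \<beta>, m) \<in> r" by auto
        have cb: "c b \<in> Field r" using c insert by auto
        from total_r[OF cb m(1)] show ?case
        proof
          assume "(c b, m) \<in> r"
          with m show ?thesis by auto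
        next
          assume "(m, c b) \<in> r"
          with m cb refl_r[OF cb] show ?thesis by (blast intro: trans_r)
        qed
      qed
      then obtain m where m: "m \<in> Field r" "\<forall>\<beta>\<in>Field s. (c \<beta>, m) \<in> r" using fin by blast
      obtain n where n: "n \<in> Field r" "m \<noteq> n" "(m, n) \<in> r" using no_max[OF m(1)] by blast
      obtain \<beta> where "\<beta> \<in> Field s" "(n, c \<beta>) \<in> r" using cof[OF n(1)] by blast
      then have "(n, m) \<in> r" using m(2) trans_r by blast
      with n antisym_r show False by blast
    qed
    have bounded: "\<exists>\<gamma>. \<gamma> \<in> Field r \<and> (\<forall>\<beta>'\<in>underS s \<beta>. (\<gamma>, c \<beta>') \<notin> r)" if b: "\<beta> \<in> Field s" for \<beta>
    proof (rule ccontr)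
      assume "\<not> ?thesis"
      then have *: "\<forall>\<gamma>\<in>Field r. \<exists>\<beta>'\<in>underS s \<beta>. (\<gamma>, c \<beta>') \<in> r" by blast
      have "c ` underS s \<beta> \<subseteq> Field r" using c by (force simp: underS_def Field_def)
      then have "c ` Field (card_of (underS s \<beta>)) \<subseteq> Field r"
        and "\<forall>\<gamma>\<in>Field r. \<exists>\<beta>'\<in>Field (card_of (underS s \<beta>)). (\<gamma>, c \<beta>') \<in> r"
        using * by (simp_all only: Field_card_of)
      then have "P (card_of (underS s \<beta>))"
        unfolding P_def using card_of_Card_order by blast
      moreover have "(card_of (underS s \<beta>), s) \<in> ordLess"
        using card_of_underS[OF cards b] .
      ultimately show False using least by blast
    qed
    define h where "h \<beta> = (SOME \<gamma>. \<gamma> \<in> Field r \<and> (\<forall>\<beta>'\<in>underS s \<beta>. (\<gamma>, c \<beta>') \<notin> r))" for \<beta>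
    have h: "h \<beta> \<in> Field r \<and> (\<forall>\<beta>'\<in>underS s \<beta>. (h \<beta>, c \<beta>') \<notin> r)" if "\<beta> \<in> Field s" for \<beta>
      unfolding h_def by (rule someI_ex[OF bounded[OF that]])
    show ?thesis
    proof (rule key[of h s])
      show "h ` Field s \<subseteq> Field r" using h by auto
      show "Cinfinite s" using infs cards by (auto simp: cinfinite_def)
      fix \<gamma> assume g: "\<gamma> \<in> Field r"
      obtain \<beta> where b: "\<beta> \<in> Field s" "(\<gamma>, c \<beta>) \<in> r" using cof[OF g] by blast
      have "h \<alpha> \<in> aboveS r \<gamma>" if a: "\<alpha> \<in> aboveS s \<beta>" for \<alpha>
      proof -
        have "\<alpha> \<in> Field s" "\<beta> \<in> underS s \<alpha>"
          using a by (auto simp: aboveS_def underS_def Field_def)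
        then have hr: "h \<alpha> \<in> Field r" and nr: "(h \<alpha>, c \<beta>) \<notin> r" using h by auto
        have "\<not> (h \<alpha>, \<gamma>) \<in> r" using nr b(2) trans_r by blast
        with total_r[OF hr g] refl_r[OF g] show ?thesis by (auto simp: aboveS_def)
      qed
      with b(1) show "\<exists>\<beta>\<in>Field s. f ` h ` aboveS s \<beta> \<subseteq> f ` aboveS r \<gamma>" by blast
    qed
  qed
qed

corollary pseudoradialI_any_index:
  fixes X :: "'a topology"
  assumes "\<And>A. A \<subseteq> topspace X \<Longrightarrow> \<not> closedin X A \<Longrightarrow>
     \<exists>x \<in> (X closure_of A) - A. \<exists>(r :: 'i rel) f.
        Cinfinite r \<and> f ` Field r \<subseteq> A \<and> transfinite_converges X r f x"
  shows "pseudoradial X"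
  unfolding pseudoradial_def
proof (intro allI impI)
  fix A assume "A \<subseteq> topspace X \<and> \<not> closedin X A"
  then obtain x and r :: "'i rel" and f where x: "x \<in> (X closure_of A) - A"
    and r: "Cinfinite r" and f: "f ` Field r \<subseteq> A" and conv: "transfinite_converges X r f x"
    using assms[of A] by blast
  from transfinite_converges_reindex[OF r f conv] x
  show "\<exists>x \<in> (X closure_of A) - A. \<exists>(r :: ('a + nat) rel) f.
          Cinfinite r \<and> f ` Field r \<subseteq> A \<and> transfinite_converges X r f x"
    by blast
qed

end

theory Submission
  imports Defs
begin

text \<open>
  The space is \<open>\<omega>\<^sub>1 \<times> \<omega>\<^sub>2\<close> together with the corner \<open>(\<omega>\<^sub>1, \<omega>\<^sub>2)\<close>, as a subspace of
  \<open>(\<omega>\<^sub>1 + 1) \<times> (\<omega>\<^sub>2 + 1)\<close>. It is countably compact because countable sets of non-corner points lie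
  in compact boxes \<open>[0, a] \<times> [0, b]\<close>. It is weakly Whyburn because the product order is well-founded
  with clopen principal down-sets: the part of a non-closed set \<open>A\<close> below a minimal point \<open>p\<close> of
  \<open>closure A - A\<close> is almost closed and converges to \<open>p\<close>. It is not pseudoradial because the corner is
  the only limit of its complement, and a transfinite sequence converging to it would have
  cofinality both \<open>\<omega>\<^sub>1\<close> and \<open>\<omega>\<^sub>2\<close>.
\<close>

section \<open>Invariance under homeomorphisms\<close>

text \<open>The space is built on pairs of ordinals and then carried over to
  \<open>nat set set\<close> along an injection; this lemma and the following ones transport its
  properties.\<close>

lemma countably_compact_space_continuous_map_image:
  assumes "countably_compact_space X" "continuous_map X Y f" "f ` topspace X = topspace Y"
  shows "countably_compact_space Y"
  unfolding countably_compact_space_def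
proof (intro allI impI, elim conjE)
  fix \<C> assume \<C>: "countable \<C>" "\<forall>U\<in>\<C>. openin Y U" "topspace Y \<subseteq> \<Union>\<C>"
  define g where "g U = {x \<in> topspace X. f x \<in> U}" for U
  have "\<forall>U\<in>g ` \<C>. openin X U"
    using \<C>(2) assms(2) by (auto simp: g_def intro: openin_continuous_map_preimage)
  moreover have "topspace X \<subseteq> \<Union>(g ` \<C>)"
    using \<C>(3) assms(3) by (fastforce simp: g_def)
  ultimately obtain \<D> where "finite \<D>" "\<D> \<subseteq> g ` \<C>" "topspace X \<subseteq> \<Union>\<D>"
    using assms(1) \<C>(1) unfolding countably_compact_space_def by (meson countable_image)
  then obtain \<E> where \<E>: "finite \<E>" "\<E> \<subseteq> \<C>" "topspace X \<subseteq> \<Union>(g ` \<E>)"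
    by (metis finite_subset_image)
  have "topspace Y \<subseteq> \<Union>\<E>"
    using \<E>(3) unfolding assms(3)[symmetric] by (fastforce simp: g_def)
  with \<E> show "\<exists>\<D>. finite \<D> \<and> \<D> \<subseteq> \<C> \<and> topspace Y \<subseteq> \<Union>\<D>" by blast
qed

lemma weakly_Whyburn_homeomorphic_map:
  assumes X: "weakly_Whyburn X" and f: "homeomorphic_map X Y f"
  shows "weakly_Whyburn Y"
  unfolding weakly_Whyburn_def
proof (intro allI impI, elim conjE)
  fix A assume A: "A \<subseteq> topspace Y" "\<not> closedin Y A"
  have inj: "inj_on f (topspace X)" and im: "f ` topspace X = topspace Y"
    using f by (auto simp: homeomorphic_eq_everything_map)
  obtain A' where A': "A' \<subseteq> topspace X" "A = f ` A'"
    using A(1) im by (metis subset_imageE)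
  then have "\<not> closedin X A'"
    using A(2) homeomorphic_map_closedness[OF f] by blast
  then obtain B x where B: "B \<subseteq> A'" "x \<notin> A'" and cl: "(X closure_of B) - B = {x}"
    using X A'(1) unfolding weakly_Whyburn_def almost_closed_converging_def by meson
  have x: "x \<in> topspace X" using cl closure_of_subset_topspace by fastforce
  have BX: "B \<subseteq> topspace X" using B A' by blast
  have "(Y closure_of f ` B) - f ` B = f ` (X closure_of B) - f ` B"
    using homeomorphic_map_closure_of[OF f BX] by simp
  also have "\<dots> = f ` ((X closure_of B) - B)"
    using inj_on_image_set_diff[OF inj _ BX] closure_of_subset_topspace by (metis Diff_subset subset_trans)
  finally have "almost_closed_converging Y (f ` B) (f x)"
    using cl image_mono[OF BX, of f] im by (simp add: almost_closed_converging_def)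
  moreover have "f x \<notin> A" using A' B x inj by (auto dest: inj_onD)
  moreover have "f ` B \<subseteq> A" using A' B by auto
  ultimately show "\<exists>B x. B \<subseteq> A \<and> x \<notin> A \<and> almost_closed_converging Y B x" by blast
qed

lemma transfinite_converges_continuous_map:
  assumes "transfinite_converges X r f x" "continuous_map X Y g"
  shows "transfinite_converges Y r (g \<circ> f) (g x)"
  unfolding transfinite_converges_def
proof (intro conjI allI impI)
  show "(g \<circ> f) ` Field r \<subseteq> topspace Y" "g x \<in> topspace Y"
    using assms continuous_map_image_subset_topspace[OF assms(2)]
    by (auto simp: transfinite_converges_def)
  fix U assume "openin Y U \<and> g x \<in> U"
  then have "openin X {z \<in> topspace X. g z \<in> U} \<and> x \<in> {z \<in> topspace X. g z \<in> U}"
    using assms by (auto simp: transfinite_converges_def intro: openin_continuous_map_preimage)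
  then obtain \<beta> where "\<beta> \<in> Field r" "f ` aboveS r \<beta> \<subseteq> {z \<in> topspace X. g z \<in> U}"
    using assms(1) unfolding transfinite_converges_def by meson
  then show "\<exists>\<beta>\<in>Field r. (g \<circ> f) ` aboveS r \<beta> \<subseteq> U" by auto
qed

lemma pseudoradial_homeomorphic_map:
  fixes X :: "'a topology"
  assumes X: "pseudoradial X" and f: "homeomorphic_map X Y f"
  shows "pseudoradial Y"
\<comment> \<open>Sequences in \<open>X\<close> are indexed by cardinals on \<open>'a + nat\<close>,
  which is not the index type that the definition prescribes for \<open>Y\<close>.\<close>
proof (rule pseudoradialI_any_index[where 'i = "'a + nat"])
  fix A assume A: "A \<subseteq> topspace Y" "\<not> closedin Y A"
  have inj: "inj_on f (topspace X)" and im: "f ` topspace X = topspace Y" and cont: "continuous_map X Y f"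
    using f by (auto simp: homeomorphic_eq_everything_map)
  obtain A' where A': "A' \<subseteq> topspace X" "A = f ` A'"
    using A(1) im by (metis subset_imageE)
  then have "\<not> closedin X A'"
    using A(2) homeomorphic_map_closedness[OF f] by blast
  then obtain x and r :: "('a + nat) rel" and h where x: "x \<in> (X closure_of A') - A'" and r: "Cinfinite r" "h ` Field r \<subseteq> A'"
      and conv: "transfinite_converges X r h x"
    using X A'(1) unfolding pseudoradial_def by meson
  have "f x \<in> (Y closure_of A) - A"
    using x inj A' homeomorphic_map_closure_of[OF f A'(1)] in_closure_of[of x X]
    by (auto dest: inj_onD)
  moreover have "(f \<circ> h) ` Field r \<subseteq> A" using r A' by auto
  ultimately show "\<exists>y \<in> (Y closure_of A) - A. \<exists>(r :: ('a + nat) rel) f.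
        Cinfinite r \<and> f ` Field r \<subseteq> A \<and> transfinite_converges Y r f y"
    using transfinite_converges_continuous_map[OF conv cont] r(1)
    by (intro bexI[of _ "f x"] exI[of _ r] exI[of _ "f \<circ> h"] conjI) auto
qed

lemma ex_homeomorphic_copy:
  fixes e :: "'a \<Rightarrow> 'b"
  assumes "inj_on e (topspace X)"
  shows "\<exists>Y :: 'b topology. homeomorphic_map X Y e"
proof -
  define g where "g = inv_into (topspace X) e"
  \<comment> \<open>Pulling back along the inverse \<open>g\<close> makes both \<open>e\<close> and
    \<open>g\<close> continuous.\<close>
  define Y where "Y = pullback_topology (e ` topspace X) g X"
  have im: "g y \<in> topspace X" "e (g y) = y" if "y \<in> e ` topspace X" for y
    using that by (auto simp: g_def inv_into_into f_inv_into_f)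
  have ge: "g (e x) = x" if "x \<in> topspace X" for x
    using that assms by (simp add: g_def inv_into_f_f)
  have top: "topspace Y = e ` topspace X"
    using im by (auto simp: Y_def topspace_pullback_topology)
  have "continuous_map X Y e"
    unfolding Y_def
  proof (rule continuous_map_pullback')
    show "continuous_map X X (g \<circ> e)"
      by (rule continuous_map_eq[OF continuous_map_id]) (simp add: ge)
  qed auto
  moreover have "continuous_map Y X g"
    using continuous_map_pullback[OF continuous_map_id, of "e ` topspace X" g X]
    by (simp add: Y_def)
  ultimately have "homeomorphic_maps X Y e g"
    by (simp add: homeomorphic_maps_def ge im top)
  then show ?thesis using homeomorphic_map_maps by blast
qed

section \<open>Topologies generated by lower sets\<close>

definition lower_cone :: "'a set set \<Rightarrow> 'a \<Rightarrow> 'a set" where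
  "lower_cone \<D> p = \<Inter>{D\<in>\<D>. p \<in> D}"

text \<open>
  For \<open>\<D>\<close> the initial segments of an ordinal this is the order topology. The members of \<open>\<D>\<close>
  become clopen, and \<open>lower_cone \<D> p\<close> is the set of points below \<open>p\<close> in the specialization preorder
  of \<open>\<D>\<close>. It is clopen even when it is an infinite
  intersection.
\<close>

definition cone_topology :: "'a set set \<Rightarrow> 'a topology" where
  "cone_topology \<D> = topology (\<lambda>U. \<forall>p\<in>U. \<exists>F. finite F \<and> F \<subseteq> \<D> \<and> p \<notin> \<Union>F \<and> lower_cone \<D> p - \<Union>F \<subseteq> U)"

text \<open>Two finite families that witness openness at \<open>p\<close> merge into their union, so
  these sets are closed under binary intersection and form a topology.\<close>

lemma openin_cone_topology:
  "openin (cone_topology \<D>) U \<longleftrightarrow>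
     (\<forall>p\<in>U. \<exists>F. finite F \<and> F \<subseteq> \<D> \<and> p \<notin> \<Union>F \<and> lower_cone \<D> p - \<Union>F \<subseteq> U)"
proof -
  let ?P = "\<lambda>U. \<forall>p\<in>U. \<exists>F. finite F \<and> F \<subseteq> \<D> \<and> p \<notin> \<Union>F \<and> lower_cone \<D> p - \<Union>F \<subseteq> U"
  have "?P (S \<inter> T)" if S: "?P S" and T: "?P T" for S T
  proof
    fix p assume p: "p \<in> S \<inter> T"
    then obtain F G where "finite F" "F \<subseteq> \<D>" "p \<notin> \<Union>F" "lower_cone \<D> p - \<Union>F \<subseteq> S"
      "finite G" "G \<subseteq> \<D>" "p \<notin> \<Union>G" "lower_cone \<D> p - \<Union>G \<subseteq> T"
      using bspec[OF S IntD1[OF p]] bspec[OF T IntD2[OF p]] by blast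
    then show "\<exists>F. finite F \<and> F \<subseteq> \<D> \<and> p \<notin> \<Union>F \<and> lower_cone \<D> p - \<Union>F \<subseteq> S \<inter> T"
      by (intro exI[of _ "F \<union> G"]) auto
  qed
  moreover have "?P (\<Union>\<K>)" if \<K>: "\<forall>K\<in>\<K>. ?P K" for \<K>
  proof
    fix p assume "p \<in> \<Union>\<K>"
    then obtain K where K: "K \<in> \<K>" "p \<in> K" by blast
    then obtain F where "finite F" "F \<subseteq> \<D>" "p \<notin> \<Union>F" "lower_cone \<D> p - \<Union>F \<subseteq> K"
      using bspec[OF bspec[OF \<K> K(1)] K(2)] by blast
    then show "\<exists>F. finite F \<and> F \<subseteq> \<D> \<and> p \<notin> \<Union>F \<and> lower_cone \<D> p - \<Union>F \<subseteq> \<Union>\<K>"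
      using K(1) by (intro exI[of _ F]) auto
  qed
  ultimately have "istopology ?P" unfolding istopology_def by blast
  then show ?thesis unfolding cone_topology_def by (simp add: topology_inverse')
qed

lemma mem_cone_self: "p \<in> lower_cone \<D> p"
  by (auto simp: lower_cone_def)

lemma openin_cone_topology_lower:
  assumes "\<And>p. p \<in> U \<Longrightarrow> lower_cone \<D> p \<subseteq> U"
  shows "openin (cone_topology \<D>) U"
  unfolding openin_cone_topology
proof
  fix p assume "p \<in> U"
  then show "\<exists>F. finite F \<and> F \<subseteq> \<D> \<and> p \<notin> \<Union>F \<and> lower_cone \<D> p - \<Union>F \<subseteq> U"
    using assms by (intro exI[of _ "{}"]) auto
qed

lemma topspace_cone_topology [simp]: "topspace (cone_topology \<D>) = UNIV"
  using openin_cone_topology_lower[of UNIV \<D>] openin_subset by fastforce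

lemma openin_cone: "openin (cone_topology \<D>) (lower_cone \<D> p)"
  by (rule openin_cone_topology_lower) (auto simp: lower_cone_def)

lemma openin_generator: "D \<in> \<D> \<Longrightarrow> openin (cone_topology \<D>) D"
  by (rule openin_cone_topology_lower) (auto simp: lower_cone_def)

lemma closedin_generator:
  assumes "D \<in> \<D>"
  shows "closedin (cone_topology \<D>) D"
proof -
  have "openin (cone_topology \<D>) (- D)"
    unfolding openin_cone_topology
  proof
    fix p assume "p \<in> - D"
    then show "\<exists>F. finite F \<and> F \<subseteq> \<D> \<and> p \<notin> \<Union>F \<and> lower_cone \<D> p - \<Union>F \<subseteq> - D"
      using assms by (intro exI[of _ "{D}"]) auto
  qed
  then show ?thesis by (simp add: closedin_def Compl_eq_Diff_UNIV)
qed

lemma closedin_cone: "closedin (cone_topology \<D>) (lower_cone \<D> p)"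
\<comment> \<open>An intersection of closed sets needs a nonempty family; a point in no generator
  has the whole space as its cone.\<close>
proof (cases "{D\<in>\<D>. p \<in> D} = {}")
  case True
  then show ?thesis
    unfolding lower_cone_def True using closedin_topspace[of "cone_topology \<D>"] by simp
next
  case False
  then show ?thesis
    unfolding lower_cone_def by (intro closedin_Inter) (auto intro: closedin_generator)
qed

text \<open>Each basic neighbourhood \<open>lower_cone \<D> p - \<Union>F\<close> is clopen, so it
  and its complement separate \<open>p\<close> from a closed set.\<close>

lemma regular_space_cone_topology: "regular_space (cone_topology \<D>)"
  unfolding regular_space_def
proof (intro allI impI)
  let ?X = "cone_topology \<D>"
  fix C p assume *: "closedin ?X C \<and> p \<in> topspace ?X - C"
  then have "openin ?X (- C)" "p \<in> - C" by (auto simp: closedin_def Compl_eq_Diff_UNIV)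
  then obtain F where F: "finite F" "F \<subseteq> \<D>" "p \<notin> \<Union>F" "lower_cone \<D> p - \<Union>F \<subseteq> - C"
    unfolding openin_cone_topology by meson
  have "closedin ?X (\<Union>F)" "openin ?X (\<Union>F)"
    using F by (auto intro!: closedin_Union openin_Union intro: closedin_generator openin_generator)
  then have "openin ?X (lower_cone \<D> p - \<Union>F)" "openin ?X (- (lower_cone \<D> p - \<Union>F))"
    using closedin_cone[of \<D> p] openin_cone[of \<D> p] closedin_diff[of ?X "lower_cone \<D> p" "\<Union>F"]
    by (auto simp: closedin_def Compl_eq_Diff_UNIV)
  then show "\<exists>U V. openin ?X U \<and> openin ?X V \<and> p \<in> U \<and> C \<subseteq> V \<and> disjnt U V"
    using F mem_cone_self[of p \<D>]
    by (intro exI[of _ "lower_cone \<D> p - \<Union>F"] exI[of _ "- (lower_cone \<D> p - \<Union>F)"]) (auto simp: disjnt_def)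
qed

lemma Hausdorff_space_cone_topology:
  assumes "\<And>p q. p \<noteq> q \<Longrightarrow> \<exists>D\<in>\<D>. (p \<in> D) \<noteq> (q \<in> D)"
  shows "Hausdorff_space (cone_topology \<D>)"
  unfolding Hausdorff_space_def
proof (intro allI impI, elim conjE)
  let ?X = "cone_topology \<D>"
  fix p q :: 'a assume "p \<noteq> q"
  then obtain D where D: "D \<in> \<D>" "(p \<in> D) \<noteq> (q \<in> D)" using assms by blast
  have "openin ?X D" "openin ?X (- D)"
    using D(1) openin_generator[of D] closedin_generator[of D]
    by (auto simp: closedin_def Compl_eq_Diff_UNIV)
  with D(2) show "\<exists>U V. openin ?X U \<and> openin ?X V \<and> p \<in> U \<and> q \<in> V \<and> disjnt U V"
    by (cases "p \<in> D"; intro exI[of _ "if p \<in> D then D else - D"] exI[of _ "if p \<in> D then - D else D"])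
      (auto simp: disjnt_def)
qed

text \<open>The cone of a minimal \<open>p\<close> is closed, so the limits of the part of
  \<open>A\<close> inside it stay in the cone, where minimality leaves no new limit but
  \<open>p\<close>. The cone is also open, so \<open>p\<close> remains a limit of that part.\<close>

lemma weakly_Whyburn_cone_topology:
  assumes "wf {(q, p). q \<in> lower_cone \<D> p \<and> q \<noteq> p}"
  shows "weakly_Whyburn (cone_topology \<D>)"
  unfolding weakly_Whyburn_def
proof (intro allI impI, elim conjE)
  let ?X = "cone_topology \<D>"
  fix A assume "\<not> closedin ?X A"
  then have "?X closure_of A - A \<noteq> {}"
    using closure_of_subset_eq[of A ?X] by auto
  then have "\<exists>p\<in>?X closure_of A - A. \<forall>q. (q, p) \<in> {(q, p). q \<in> lower_cone \<D> p \<and> q \<noteq> p} \<longrightarrow>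
      q \<notin> ?X closure_of A - A"
    using assms unfolding wf_eq_minimal by blast
  then obtain p where p: "p \<in> ?X closure_of A - A"
      and min: "\<And>q. q \<in> lower_cone \<D> p \<Longrightarrow> q \<noteq> p \<Longrightarrow> q \<notin> ?X closure_of A - A"
    by auto
  let ?B = "A \<inter> lower_cone \<D> p"
  have "?X closure_of ?B - ?B \<subseteq> {p}"
  proof
    fix q assume q: "q \<in> ?X closure_of ?B - ?B"
    have "q \<in> lower_cone \<D> p"
      using q closure_of_minimal[OF _ closedin_cone, of ?B \<D> p] by blast
    moreover have "q \<in> ?X closure_of A"
      using q closure_of_mono[of ?B A ?X] by blast
    ultimately show "q \<in> {p}" using min[of q] q by auto
  qed
  moreover have "p \<in> ?X closure_of ?B"
    using openin_Int_closure_of_subset[OF openin_cone[of \<D> p], of A] p mem_cone_self[of p \<D>]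
    by (auto simp: Int_commute)
  ultimately have "almost_closed_converging ?X ?B p"
    using p by (auto simp: almost_closed_converging_def)
  then show "\<exists>B x. B \<subseteq> A \<and> x \<notin> A \<and> almost_closed_converging ?X B x"
    using p by blast
qed

text \<open>An open set around \<open>p\<close> contains the cone of \<open>p\<close> up to finitely
  many generators that miss \<open>p\<close>, so only finitely many smaller pieces remain to be
  covered. This is the step for inductions along the cones.\<close>

lemma compactin_cone_topology_cone:
  assumes "\<And>D. D \<in> \<D> \<Longrightarrow> p \<notin> D \<Longrightarrow> compactin (cone_topology \<D>) (lower_cone \<D> p \<inter> D)"
  shows "compactin (cone_topology \<D>) (lower_cone \<D> p)"
  unfolding compactin_def
proof (intro conjI allI impI, simp, elim conjE)
  let ?X = "cone_topology \<D>"
  fix \<U> assume \<U>: "\<forall>U\<in>\<U>. openin ?X U" "lower_cone \<D> p \<subseteq> \<Union>\<U>"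
  then obtain U where U: "U \<in> \<U>" "p \<in> U" using mem_cone_self[of p \<D>] by blast
  then obtain F where F: "finite F" "F \<subseteq> \<D>" "p \<notin> \<Union>F" "lower_cone \<D> p - \<Union>F \<subseteq> U"
    using \<U>(1) unfolding openin_cone_topology by meson
  have "compactin ?X (\<Union>D\<in>F. lower_cone \<D> p \<inter> D)"
    using F assms by (intro compactin_Union) auto
  moreover have "(\<Union>D\<in>F. lower_cone \<D> p \<inter> D) \<subseteq> \<Union>\<U>" using \<U>(2) by auto
  ultimately have "\<exists>\<F>. finite \<F> \<and> \<F> \<subseteq> \<U> \<and> (\<Union>D\<in>F. lower_cone \<D> p \<inter> D) \<subseteq> \<Union>\<F>"
    using \<U>(1) by (intro compactinD) auto
  then obtain \<F> where \<F>: "finite \<F>" "\<F> \<subseteq> \<U>" "(\<Union>D\<in>F. lower_cone \<D> p \<inter> D) \<subseteq> \<Union>\<F>"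
    by auto
  have "lower_cone \<D> p \<subseteq> (lower_cone \<D> p - \<Union>F) \<union> (\<Union>D\<in>F. lower_cone \<D> p \<inter> D)" by auto
  also have "\<dots> \<subseteq> \<Union>(insert U \<F>)" unfolding Union_insert using F(4) \<F>(3) by (rule Un_mono)
  finally have "lower_cone \<D> p \<subseteq> \<Union>(insert U \<F>)" .
  then show "\<exists>\<F>. finite \<F> \<and> \<F> \<subseteq> \<U> \<and> lower_cone \<D> p \<subseteq> \<Union>\<F>"
    using \<F> U by (intro exI[of _ "insert U \<F>"]) auto
qed

section \<open>The product of two ordinals with a corner point\<close>

text \<open>
  \<^term>\<open>None\<close> is the corner: it lies in no strip, so its cone is the whole space and its basic
  neighbourhoods are the complements of finite unions of strips.
\<close>

definition strips :: "('a::linorder \<times> 'b::linorder) option set set" where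
  "strips = range (\<lambda>a. Some ` ({..a} \<times> UNIV)) \<union> range (\<lambda>b. Some ` (UNIV \<times> {..b}))"

lemma lower_cone_strips_None: "lower_cone strips None = UNIV"
  by (auto simp: lower_cone_def strips_def)

lemma lower_cone_strips_Some: "lower_cone strips (Some (a, b)) = Some ` ({..a} \<times> {..b})"
proof
  have "Some ` ({..a} \<times> UNIV) \<in> {D\<in>strips. Some (a, b) \<in> D}"
    "Some ` (UNIV \<times> {..b}) \<in> {D\<in>strips. Some (a, b) \<in> D}"
    by (auto simp: strips_def)
  then have "lower_cone strips (Some (a, b)) \<subseteq> Some ` ({..a} \<times> UNIV)"
    "lower_cone strips (Some (a, b)) \<subseteq> Some ` (UNIV \<times> {..b})"
    unfolding lower_cone_def by (auto intro: Inter_lower)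
  then show "lower_cone strips (Some (a, b)) \<subseteq> Some ` ({..a} \<times> {..b})" by auto
qed (auto simp: lower_cone_def strips_def intro!: image_eqI)

lemma strips_separate:
  assumes "p \<noteq> q"
  shows "\<exists>D\<in>strips. (p \<in> D) \<noteq> (q \<in> D)"
proof (rule ccontr)
  assume "\<not> ?thesis"
  \<comment> \<open>Points in the same generators lie in each other's cones, and the order given by
    the cones is antisymmetric.\<close>
  then have "q \<in> lower_cone strips p" "p \<in> lower_cone strips q" by (auto simp: lower_cone_def)
  with assms show False
    by (cases p; cases q) (auto simp: lower_cone_strips_Some)
qed

lemma wf_cone_strips:
  "wf {(q, p :: ('a::wellorder \<times> 'b::wellorder) option). q \<in> lower_cone strips p \<and> q \<noteq> p}"
proof (rule wfI_min)
  fix x and Q :: "('a \<times> 'b) option set" assume x: "x \<in> Q"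
  show "\<exists>z\<in>Q. \<forall>y. (y, z) \<in> {(q, p). q \<in> lower_cone strips p \<and> q \<noteq> p} \<longrightarrow> y \<notin> Q"
  \<comment> \<open>The corner is minimal only in \<open>{None}\<close>; otherwise the
    lexicographically least pair in \<open>Q\<close> is minimal for the product order.\<close>
  proof (cases "Q = {None}")
    case False
    with x have "\<not> Q \<subseteq> {None}" by auto
    then obtain p where "p \<in> Q" "p \<noteq> None" by blast
    then obtain a b where "Some (a, b) \<in> Q" by auto
    then obtain a where a: "\<exists>b. Some (a, b) \<in> Q" "\<And>x. \<exists>b. Some (x, b) \<in> Q \<Longrightarrow> a \<le> x"
      using exists_least_iff[of "\<lambda>a. \<exists>b. Some (a, b) \<in> Q"] by (metis not_less)
    then obtain b where b: "Some (a, b) \<in> Q" "\<And>y. Some (a, y) \<in> Q \<Longrightarrow> b \<le> y"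
      using exists_least_iff[of "\<lambda>b. Some (a, b) \<in> Q"] by (metis not_less)
    have "q \<notin> Q" if "q \<in> lower_cone strips (Some (a, b))" "q \<noteq> Some (a, b)" for q
      using that a(2) b(2) by (fastforce simp: lower_cone_strips_Some)
    with b(1) show ?thesis by blast
  qed auto
qed

text \<open>A strip that misses \<open>(a, b)\<close> cuts the box below it down to a box with a
  smaller first or second coordinate, which calls for two nested inductions.\<close>

lemma compactin_cone_strips:
  fixes a :: "'a::wellorder" and b :: "'b::wellorder"
  shows "compactin (cone_topology strips) (lower_cone strips (Some (a, b)))"
proof (induction a arbitrary: b rule: less_induct)
  case (less a)
  note outer = less
  show ?case
  proof (induction b rule: less_induct)
    case (less b)
    show ?case
    proof (rule compactin_cone_topology_cone)
      fix D assume D: "D \<in> strips" "Some (a, b) \<notin> D"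
      then consider c where "D = Some ` ({..c} \<times> UNIV)" "c < a"
        | d where "D = Some ` (UNIV \<times> {..d})" "d < b"
        by (fastforce simp: strips_def)
      then show "compactin (cone_topology strips) (lower_cone strips (Some (a, b)) \<inter> D)"
      proof cases
        case 1
        then have "lower_cone strips (Some (a, b)) \<inter> D = lower_cone strips (Some (c, b))"
          by (auto simp: lower_cone_strips_Some)
        then show ?thesis using outer 1 by simp
      next
        case 2
        then have "lower_cone strips (Some (a, b)) \<inter> D = lower_cone strips (Some (a, d))"
          by (auto simp: lower_cone_strips_Some)
        then show ?thesis using less 2 by simp
      qed
    qed
  qed
qed

lemma countably_compact_space_strips:
  assumes a: "\<And>A :: 'a::wellorder set. countable A \<Longrightarrow> \<exists>m. \<forall>x\<in>A. x < m"
    and b: "\<And>B :: 'b::wellorder set. countable B \<Longrightarrow> \<exists>m. \<forall>x\<in>B. x < m"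
  shows "countably_compact_space (cone_topology (strips :: ('a \<times> 'b) option set set))"
  unfolding countably_compact_space_def
proof (intro allI impI, elim conjE)
  let ?X = "cone_topology (strips :: ('a \<times> 'b) option set set)"
  fix \<C> assume \<C>: "countable \<C>" "\<forall>U\<in>\<C>. openin ?X U" "topspace ?X \<subseteq> \<Union>\<C>"
  show "\<exists>\<D>. finite \<D> \<and> \<D> \<subseteq> \<C> \<and> topspace ?X \<subseteq> \<Union>\<D>"
  proof (rule ccontr)
    assume no: "\<not> ?thesis"
    define U where "U = from_nat_into \<C>"
    have "\<C> \<noteq> {}" using \<C>(3) by auto
    then have U: "range U = \<C>" using \<C>(1) by (simp add: U_def range_from_nat_into)
    have "\<exists>p. p \<notin> (\<Union>i<n. U i)" for n :: nat
    proof -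
      have "finite (U ` {..<n}) \<and> U ` {..<n} \<subseteq> \<C>" using U by auto
      then have "\<not> topspace ?X \<subseteq> \<Union>(U ` {..<n})" using no by blast
      then show ?thesis by auto
    qed
    \<comment> \<open>The point \<open>p n\<close> escapes the first \<open>n\<close> members of the
      cover. Past the index \<open>k\<close> of a member around the corner, all these points lie in
      one compact box.\<close>
    then obtain p where p: "\<And>n. p n \<notin> (\<Union>i<n. U i)" by metis
    obtain k where k: "None \<in> U k" using \<C>(3) U by auto
    have some: "p n \<noteq> None" if "k < n" for n using p[of n] k that by (metis UN_I lessThan_iff)
    \<comment> \<open>For \<open>n \<le> k\<close> the point \<open>p n\<close> may be the corner,
      where \<open>the\<close> is arbitrary; \<open>in_cone\<close> concerns \<open>k < n\<close>
      only.\<close>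
    obtain a where a: "\<And>n. fst (the (p n)) < a" using a[of "range (\<lambda>n. fst (the (p n)))"] by auto
    obtain b where b: "\<And>n. snd (the (p n)) < b" using b[of "range (\<lambda>n. snd (the (p n)))"] by auto
    have in_cone: "p n \<in> lower_cone strips (Some (a, b))" if "k < n" for n
      using some[OF that] a[of n] b[of n]
      by (cases "p n") (auto simp: lower_cone_strips_Some image_iff mem_Times_iff)
    have "\<exists>\<F>. finite \<F> \<and> \<F> \<subseteq> \<C> \<and> lower_cone strips (Some (a, b)) \<subseteq> \<Union>\<F>"
      using \<C> by (intro compactinD[OF compactin_cone_strips]) auto
    then obtain \<F> where \<F>: "finite \<F>" "\<F> \<subseteq> \<C>" "lower_cone strips (Some (a, b)) \<subseteq> \<Union>\<F>"
      by auto
    obtain I where "finite I" "\<F> = U ` I"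
      using finite_subset_image[OF \<F>(1), of U UNIV] \<F>(2) U by auto
    then have I: "finite I" "lower_cone strips (Some (a, b)) \<subseteq> (\<Union>i\<in>I. U i)"
      using \<F>(3) by auto
    from I(1) obtain m where m: "\<forall>i\<in>I. i < m" by (auto simp: finite_nat_set_iff_bounded)
    \<comment> \<open>Beyond \<open>k\<close> the point \<open>p n\<close> lies in the box; from
      \<open>m\<close> on it avoids all the members that cover the box.\<close>
    define n where "n = max m (Suc k)"
    have "p n \<in> (\<Union>i\<in>I. U i)" by (rule subsetD[OF I(2) in_cone]) (simp add: n_def)
    moreover have "I \<subseteq> {..<n}" using m by (auto simp: n_def less_max_iff_disj)
    ultimately show False using p[of n] by blast
  qed
qed

text \<open>
  A sequence of length \<open>\<kappa>\<close> converging to the corner would force both cofinalities to equal the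
  cofinality of \<open>\<kappa>\<close>, which \<open>regular\<close> excludes. Here \<open>\<gamma> a\<close> and \<open>\<delta> b\<close> are stages of the
  sequence after which the coordinates stay above \<open>a\<close> and \<open>b\<close>.
\<close>

lemma not_pseudoradial_strips:
  assumes a: "\<And>x :: 'a::wellorder. \<exists>m. x < m"
    and b: "\<And>x :: 'b::wellorder. \<exists>m. x < m"
    and regular: "\<And>h :: 'a \<Rightarrow> 'b. \<exists>m. \<forall>x. h x < m"
  shows "\<not> pseudoradial (cone_topology (strips :: ('a \<times> 'b) option set set))"
proof
  let ?X = "cone_topology (strips :: ('a \<times> 'b) option set set)"
  assume ps: "pseudoradial ?X"
  have "None \<in> ?X closure_of (range Some)"
    unfolding in_closure_of
  proof (intro conjI allI impI, simp, elim conjE)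
    fix T assume T: "None \<in> T" "openin ?X T"
    then obtain F where F: "finite F" "F \<subseteq> strips" "UNIV - \<Union>F \<subseteq> T"
      unfolding openin_cone_topology by (metis lower_cone_strips_None)
    \<comment> \<open>Finitely many strips miss a final quadrant, so every neighbourhood of the
      corner contains other points.\<close>
    have "\<exists>a b. \<forall>x y. Some (x, y) \<in> \<Union>F \<longrightarrow> x \<le> a \<or> y \<le> b"
      using F(1,2)
    proof (induction F rule: finite_induct)
      case (insert D F)
      then obtain a b where ab: "\<And>x y. Some (x, y) \<in> \<Union>F \<Longrightarrow> x \<le> a \<or> y \<le> b" by auto
      obtain c d where cd: "\<And>x y. Some (x, y) \<in> D \<Longrightarrow> x \<le> c \<or> y \<le> d"
        using insert.prems by (fastforce simp: strips_def)
      have "\<forall>x y. Some (x, y) \<in> \<Union>(insert D F) \<longrightarrow> x \<le> max a c \<or> y \<le> max b d"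
        using ab cd by (metis Un_iff Union_insert max.coboundedI1 max.coboundedI2)
      then show ?case by blast
    qed simp
    then obtain u v where uv: "\<And>x y. Some (x, y) \<in> \<Union>F \<Longrightarrow> x \<le> u \<or> y \<le> v" by metis
    obtain x y where "u < x" "v < y" using a b by blast
    then have "Some (x, y) \<in> T" using uv[of x y] F(3) by fastforce
    then show "\<exists>y. y \<in> range Some \<and> y \<in> T" by blast
  qed
  then have "\<not> closedin ?X (range Some)"
    using closure_of_closedin by fastforce
  then obtain x and r :: "(('a \<times> 'b) option + nat) rel" and f where
      x: "x \<in> ?X closure_of (range Some) - range Some" and r: "Cinfinite r"
      and f: "f ` Field r \<subseteq> range Some" and conv: "transfinite_converges ?X r f x"
    using ps unfolding pseudoradial_def by (metis subset_UNIV topspace_cone_topology)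
  have "x = None" using x by (cases x) auto
  interpret r: wo_rel r
    using r by (auto simp: wo_rel_def card_order_on_def)
  have ex_above: "\<exists>\<xi>. \<xi> \<in> aboveS r \<beta> \<and> f \<xi> \<noteq> None" if \<beta>: "\<beta> \<in> Field r" for \<beta>
  proof -
    obtain \<xi> where \<xi>: "\<xi> \<in> Field r" "\<beta> \<noteq> \<xi>" "(\<beta>, \<xi>) \<in> r"
      using infinite_Card_order_limit[of r \<beta>] r \<beta> by (auto simp: cinfinite_def)
    have "f \<xi> \<in> range Some" by (rule subsetD[OF f imageI[OF \<xi>(1)]])
    then have "\<xi> \<in> aboveS r \<beta> \<and> f \<xi> \<noteq> None" using \<xi> by (auto simp: aboveS_def)
    then show ?thesis ..
  qed
  \<comment> \<open>A strip is closed and misses the corner, so the sequence eventually leaves it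
    for good.\<close>
  have "\<exists>\<beta>\<in>Field r. f ` aboveS r \<beta> \<subseteq> - D" if "D \<in> strips" for D
  proof -
    have "openin ?X (- D)" using closedin_generator[OF that] by (simp add: closedin_def Compl_eq_Diff_UNIV)
    moreover have "None \<in> - D" using that by (auto simp: strips_def)
    ultimately show ?thesis using conv \<open>x = None\<close> unfolding transfinite_converges_def by blast
  qed
  note tail = this
  have "\<exists>\<beta>\<in>Field r. \<forall>\<xi>\<in>aboveS r \<beta>. f \<xi> \<notin> Some ` ({..a} \<times> UNIV)" for a
    using tail[of "Some ` ({..a} \<times> UNIV)"] by (fastforce simp: strips_def)
  then obtain \<gamma> where \<gamma>: "\<And>a. \<gamma> a \<in> Field r"
    "\<And>a \<xi>. \<xi> \<in> aboveS r (\<gamma> a) \<Longrightarrow> f \<xi> \<notin> Some ` ({..a} \<times> UNIV)" by metis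
  have "\<exists>\<beta>\<in>Field r. \<forall>\<xi>\<in>aboveS r \<beta>. f \<xi> \<notin> Some ` (UNIV \<times> {..b})" for b
    using tail[of "Some ` (UNIV \<times> {..b})"] by (fastforce simp: strips_def)
  then obtain \<delta> where \<delta>: "\<And>b. \<delta> b \<in> Field r"
    "\<And>b \<xi>. \<xi> \<in> aboveS r (\<delta> b) \<Longrightarrow> f \<xi> \<notin> Some ` (UNIV \<times> {..b})" by metis
  obtain \<xi> where \<xi>: "\<And>a. \<xi> a \<in> aboveS r (\<gamma> a)" "\<And>a. f (\<xi> a) \<noteq> None"
    using ex_above[OF \<gamma>(1)] by metis
  \<comment> \<open>One stage \<open>\<xi> a\<close> past each \<open>\<gamma> a\<close> has been
    chosen; \<open>regular\<close> bounds all their second coordinates at once.\<close>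
  obtain m where m: "\<And>a. snd (the (f (\<xi> a))) < m"
    using regular[of "\<lambda>a. snd (the (f (\<xi> a)))"] by blast
  obtain \<zeta> where \<zeta>: "\<zeta> \<in> aboveS r (\<delta> m)" "f \<zeta> \<noteq> None"
    using ex_above[OF \<delta>(1)] by blast
  then obtain c d where cd: "f \<zeta> = Some (c, d)" by auto
  \<comment> \<open>The stage \<open>\<xi> c\<close> is not past \<open>\<delta> m\<close>, as its
    second coordinate is below \<open>m\<close>. Hence
    \<open>\<gamma> c < \<xi> c \<le> \<delta> m < \<zeta>\<close> in \<open>r\<close>, although the
    first coordinate of \<open>f \<zeta>\<close> is only \<open>c\<close>.\<close>
  have "\<zeta> \<in> aboveS r (\<gamma> c)"
  proof -
    have "\<xi> c \<notin> aboveS r (\<delta> m)"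
      using \<delta>(2)[of "\<xi> c" m] m[of c] \<xi>(2)[of c] by (force simp: image_iff)
    then show ?thesis using \<xi>(1)[of c] \<zeta>(1) \<gamma>(1)[of c] \<delta>(1)[of m]
      r.TRANS r.TOTALS r.ANTISYM unfolding aboveS_def trans_def antisym_def
      by (smt (verit) FieldI2 mem_Collect_eq)
  qed
  then show False using \<gamma>(2)[of \<zeta> c] cd by auto
qed

section \<open>Successor cardinals as types\<close>

instantiation suc :: (type) wellorder
begin

text \<open>A cardinal order has the least order type of its cardinality, so \<open>nat suc\<close>
  becomes a copy of \<open>\<omega>\<^sub>1\<close> and \<open>nat suc suc\<close> one of
  \<open>\<omega>\<^sub>2\<close>.\<close>

definition less_eq_suc :: "'a suc \<Rightarrow> 'a suc \<Rightarrow> bool" where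
  "less_eq_suc x y \<longleftrightarrow> (x, y) \<in> card_suc (card_of (UNIV :: 'a set))"

definition less_suc :: "'a suc \<Rightarrow> 'a suc \<Rightarrow> bool" where
  "less_suc x y \<longleftrightarrow> x \<le> y \<and> \<not> y \<le> x"

instance
proof -
  let ?r = "card_suc (card_of (UNIV :: 'a set))"
  have wo: "well_order_on UNIV ?r"
    using card_order_card_suc[OF card_of_card_order_on[of "UNIV :: 'a set"]] by (simp add: card_order_on_def)
  interpret r: wo_rel ?r
    using wo by (simp add: wo_rel_def Field_card_suc)
  show "OFCLASS('a suc, wellorder_class)"
  proof
    fix x y z :: "'a suc" and P
    show "x < y \<longleftrightarrow> x \<le> y \<and> \<not> y \<le> x" by (simp add: less_suc_def)
    show "x \<le> x" using r.REFL by (simp add: less_eq_suc_def refl_on_def Field_card_suc)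
    show "x \<le> y \<Longrightarrow> y \<le> z \<Longrightarrow> x \<le> z" using r.TRANS unfolding less_eq_suc_def trans_def by blast
    show "x \<le> y \<Longrightarrow> y \<le> x \<Longrightarrow> x = y" using r.ANTISYM unfolding less_eq_suc_def antisym_def by blast
    show "x \<le> y \<or> y \<le> x" using r.TOTALS unfolding less_eq_suc_def Field_card_suc by blast
    assume step: "\<And>x :: 'a suc. (\<And>y. y < x \<Longrightarrow> P y) \<Longrightarrow> P x"
    show "P x"
    proof (rule r.well_order_induct)
      fix x assume IH: "\<forall>y. y \<noteq> x \<and> (y, x) \<in> ?r \<longrightarrow> P y"
      show "P x" by (rule step) (use IH in \<open>auto simp: less_suc_def less_eq_suc_def\<close>)
    qed
  qed
qed

end

text \<open>Infinite successor cardinals are regular, so a set this small lies in a single segment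
  \<open>{..i}\<close>. The bound becomes strict because an infinite cardinal order has no greatest
  element.\<close>

lemma suc_bounded:
  fixes B :: "'a suc set"
  assumes inf: "infinite (UNIV :: 'a set)"
    and B: "(card_of B, card_of (UNIV :: 'a set)) \<in> ordLeq"
  shows "\<exists>m. \<forall>x\<in>B. x < m"
proof -
  let ?r = "card_suc (card_of (UNIV :: 'a set))"
  have co: "card_order (card_of (UNIV :: 'a set))" by (rule card_of_card_order_on)
  have Ci: "Cinfinite (card_of (UNIV :: 'a set))"
    using inf by (simp add: cinfinite_def Field_card_of card_of_card_order_on)
  have r: "Card_order ?r" "infinite (Field ?r)"
    using Cinfinite_card_suc[OF Ci co] by (auto simp: cinfinite_def)
  have reg: "regularCard ?r" by (rule regularCard_card_suc[OF co Ci])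
  have "\<exists>i\<in>Field ?r. B \<le> {..i}"
  proof (rule regularCard_UNION[OF r(1) reg])
    show "relChain ?r atMost" by (auto simp: relChain_def less_eq_suc_def[symmetric])
    show "B \<le> (\<Union>i\<in>Field ?r. {..i})" by (auto simp: Field_card_suc)
    show "(card_of B, ?r) \<in> ordLess"
      using B card_suc_greater[OF co] by (rule ordLeq_ordLess_trans)
  qed
  then obtain i where i: "B \<subseteq> {..i}" by blast
  obtain m where "i \<noteq> m" "(i, m) \<in> ?r"
    using infinite_Card_order_limit[OF r, of i] by (auto simp: Field_card_suc)
  then have "i < m" by (simp add: less_eq_suc_def[symmetric] order.strict_iff_order)
  with i show ?thesis by (meson atMost_iff le_less_trans subsetD)
qed

lemma infinite_UNIV_suc:
  assumes "infinite (UNIV :: 'a set)"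
  shows "infinite (UNIV :: 'a suc set)"
  using Cinfinite_card_suc[OF _ card_of_card_order_on[of "UNIV :: 'a set"]] assms
  by (simp add: cinfinite_def Field_card_suc Field_card_of card_of_card_order_on)

lemma suc_bounded_countable:
  fixes B :: "'a suc set"
  assumes inf: "infinite (UNIV :: 'a set)" and "countable B"
  shows "\<exists>m. \<forall>x\<in>B. x < m"
proof (rule suc_bounded[OF inf])
  have "(card_of B, card_of (UNIV :: nat set)) \<in> ordLeq"
    using assms(2) by (auto simp: countable_def card_of_ordLeq[symmetric])
  moreover have "(card_of (UNIV :: nat set), card_of (UNIV :: 'a set)) \<in> ordLeq"
    using inf by (simp add: infinite_iff_card_of_nat)
  ultimately show "(card_of B, card_of (UNIV :: 'a set)) \<in> ordLeq"
    by (rule ordLeq_transitive)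
qed

text \<open>With \<open>nat suc\<close> for \<open>'a\<close>, no map from
  \<open>\<omega>\<^sub>1\<close> to \<open>\<omega>\<^sub>2\<close> is cofinal, which is the
  hypothesis \<open>regular\<close> of \<open>not_pseudoradial_strips\<close>.\<close>

lemma suc_bounded_range:
  fixes h :: "'a \<Rightarrow> 'a suc"
  assumes "infinite (UNIV :: 'a set)"
  shows "\<exists>m. \<forall>x. h x < m"
  using suc_bounded[OF assms card_of_image[of h UNIV]] by blast

text \<open>Elements containing \<open>0\<close> encode the second component, the one without \<open>0\<close> the first.\<close>

lemma ex_inj_pair_option: "\<exists>e :: (nat set \<times> nat set set) option \<Rightarrow> nat set set. inj e"
proof -
  define e where "e p = (case p of None \<Rightarrow> {}
      | Some (x, Y) \<Rightarrow> insert (Suc ` x) ((\<lambda>y. insert 0 (Suc ` y)) ` Y))" for p :: "(nat set \<times> nat set set) option"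
  have x: "{z. 0 \<notin> z \<and> z \<in> e (Some (x, Y))} = {Suc ` x}" for x Y
    by (auto simp: e_def)
  have Y: "{y. insert 0 (Suc ` y) \<in> e (Some (x, Y))} = Y" for x Y
  proof -
    have "insert 0 (Suc ` y) = insert 0 (Suc ` z) \<longleftrightarrow> y = z" for y z
      by (auto simp: set_eq_iff image_iff)
    moreover have "insert 0 (Suc ` y) \<noteq> Suc ` x" for y by auto
    ultimately show ?thesis by (auto simp: e_def)
  qed
  have some: "x = x' \<and> Y = Y'" if "e (Some (x, Y)) = e (Some (x', Y'))" for x x' Y Y'
  proof
    have "{Suc ` x} = {Suc ` x'}"
      using arg_cong[OF that, of "\<lambda>E. {z. 0 \<notin> z \<and> z \<in> E}"] by (simp only: x)
    then show "x = x'" by (simp add: inj_image_eq_iff)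
    show "Y = Y'"
      using arg_cong[OF that, of "\<lambda>E. {y. insert 0 (Suc ` y) \<in> E}"] by (simp only: Y)
  qed
  have none: "e None \<noteq> e (Some (x, Y))" for x Y by (simp add: e_def)
  have "inj e"
  proof (rule injI)
    fix p q assume "e p = e q"
    then show "p = q"
      by (cases p; cases q) (auto simp: none none[symmetric] dest: some)
  qed
  then show ?thesis by blast
qed

text \<open>\<open>Rep_suc\<close> embeds \<open>'a suc\<close> into \<open>'a set\<close>; applied
  at both levels it sends \<open>nat suc\<close> into \<open>nat set\<close> and
  \<open>nat suc suc\<close> into \<open>nat set set\<close>.\<close>

lemma ex_inj_ordinal_pairs: "\<exists>e :: (nat suc \<times> nat suc suc) option \<Rightarrow> nat set set. inj e"
proof -
  have inj: "inj Rep_suc" by (simp add: inj_def Rep_suc_inject)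
  define g :: "nat suc \<times> nat suc suc \<Rightarrow> nat set \<times> nat set set"
    where "g = map_prod Rep_suc (\<lambda>z. Rep_suc ` Rep_suc z)"
  have "inj g"
    unfolding g_def by (intro prod.inj_map) (auto simp: inj_def Rep_suc_inject inj_image_eq_iff[OF inj])
  then have "inj (map_option g)" by (rule option.inj_map)
  then show ?thesis using ex_inj_pair_option by (metis inj_compose)
qed

theorem theorem3p7:
  shows "\<exists>X :: nat set set topology.
           countably_compact_space X \<and> regular_space X \<and> Hausdorff_space X \<and>
           weakly_Whyburn X \<and> \<not> pseudoradial X"
proof -
  let ?S = "strips :: (nat suc \<times> nat suc suc) option set set"
  let ?X = "cone_topology ?S"
  note inf = infinite_UNIV_suc[OF infinite_UNIV_nat]
  obtain e :: "(nat suc \<times> nat suc suc) option \<Rightarrow> nat set set" where "inj e"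
    using ex_inj_ordinal_pairs by blast
  then obtain Y :: "nat set set topology" where e: "homeomorphic_map ?X Y e"
    using ex_homeomorphic_copy[of e ?X] by auto
  \<comment> \<open>The reverse map serves the negative property: if \<open>Y\<close> were
    pseudoradial, \<open>?X\<close> would be so through \<open>g\<close>.\<close>
  then obtain g where g: "homeomorphic_map Y ?X g"
    by (metis homeomorphic_map_maps homeomorphic_maps_sym)
  have hom: "?X homeomorphic_space Y"
    using e homeomorphic_map_imp_homeomorphic_space by blast
  have "countably_compact_space ?X"
    by (intro countably_compact_space_strips suc_bounded_countable inf infinite_UNIV_nat)
  then have "countably_compact_space Y"
    using e countably_compact_space_continuous_map_image
    by (metis homeomorphic_eq_everything_map)
  moreover have "regular_space Y"
    using homeomorphic_regular_space[OF hom] regular_space_cone_topology by blast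
  moreover have "Hausdorff_space Y"
    using homeomorphic_Hausdorff_space[OF hom] Hausdorff_space_cone_topology[OF strips_separate]
    by blast
  moreover have "weakly_Whyburn Y"
    using weakly_Whyburn_homeomorphic_map[OF weakly_Whyburn_cone_topology[OF wf_cone_strips] e] .
  moreover have "\<not> pseudoradial ?X"
  proof (rule not_pseudoradial_strips)
    show "\<exists>m. x < m" for x :: "nat suc"
      using suc_bounded_countable[OF infinite_UNIV_nat, of "{x}"] by simp
    show "\<exists>m. x < m" for x :: "nat suc suc"
      using suc_bounded_countable[OF inf, of "{x}"] by simp
    show "\<exists>m. \<forall>x. h x < m" for h :: "nat suc \<Rightarrow> nat suc suc"
      by (rule suc_bounded_range[OF inf])
  qed
  then have "\<not> pseudoradial Y" using pseudoradial_homeomorphic_map[OF _ g] by blast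
  ultimately show ?thesis by auto
qed

end
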